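(* There exists a well ordered subsemigroup $U$ of $\mathbb{Q}_+$ such that $U$ has ordinal type $\omega$ and $U\neq\nu(m_A-\{0\})$ for any equicharacteristic noetherian local domain $(A,m_A)$ and any valuation $\nu$ of the quotient field of $A$ dominating $A$.
   Context: $\mathbb{Q}_+$ is the additive semigroup of positive rational numbers with its usual order, and $\omega$ is the ordinal type of the well ordered set $\mathbb{N}$. A noetherian local domain is equicharacteristic if it has the same characteristic as its residue field. A valuation $\nu$ of the quotient field of $A$, with valuation ring $V$ and maximal ideal $m_V$, dominates $A$ if $A\subset V$ and $m_V\cap A=m_A$. Value groups are totally ordered abelian groups, written additively, and $\nu(m_A-\{0\})=\{\nu(f)\mid f\in m_A,\ f\ne 0\}$ is the value semigroup of $\nu$ on $A$. The equality $U=\nu(m_A-\{0\})$ is meant with addition and order on the value group agreeing with those of $\mathbb{Q}$ (so that the value group would be an ordered subgroup of $\mathbb{Q}$). *)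

theory Defs
  imports "HOL-Algebra.Algebra"
begin

definition additive_subsemigroup :: "'g::plus set \<Rightarrow> bool" where
  "additive_subsemigroup U \<longleftrightarrow> (\<forall>x\<in>U. \<forall>y\<in>U. x + y \<in> U)"

definition well_ordered_set :: "'g::order set \<Rightarrow> bool" where
  "well_ordered_set U \<longleftrightarrow> well_order_on U (relation_of (\<le>) U)"

definition has_ordinal_type_omega :: "'g::order set \<Rightarrow> bool" where
  "has_ordinal_type_omega U \<longleftrightarrow> (relation_of (\<le>) U, natLeq) \<in> ordIso"

definition local_ring :: "'a ring \<Rightarrow> 'a set \<Rightarrow> bool" where
  "local_ring A m \<longleftrightarrow> cring A \<and> maximalideal m A \<and> (\<forall>J. maximalideal J A \<longrightarrow> J = m)"

definition ring_characteristic :: "('a, 'b) ring_scheme \<Rightarrow> nat" where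
  "ring_characteristic R =
     (if \<exists>n::nat. 0 < n \<and> [n] \<cdot>\<^bsub>R\<^esub> \<one>\<^bsub>R\<^esub> = \<zero>\<^bsub>R\<^esub>
      then LEAST n::nat. 0 < n \<and> [n] \<cdot>\<^bsub>R\<^esub> \<one>\<^bsub>R\<^esub> = \<zero>\<^bsub>R\<^esub>
      else 0)"

definition equicharacteristic_noetherian_local_domain :: "'a ring \<Rightarrow> 'a set \<Rightarrow> bool" where
  "equicharacteristic_noetherian_local_domain A m \<longleftrightarrow>
     noetherian_domain A \<and> local_ring A m \<and>
     ring_characteristic A = ring_characteristic (A Quot m)"

text \<open>The domain is regarded as an actual subring of its quotient field, so that it shares the
  operations of \<open>K\<close> and inclusions such as \<open>A \<subseteq> V\<close> can be written literally.\<close>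

definition quotient_field_of :: "'a ring \<Rightarrow> 'a ring \<Rightarrow> bool" where
  "quotient_field_of K A \<longleftrightarrow>
     field K \<and> subring (carrier A) K \<and> A = K\<lparr>carrier := carrier A\<rparr> \<and>
     (\<forall>x\<in>carrier K. \<exists>a\<in>carrier A. \<exists>b\<in>carrier A - {\<zero>\<^bsub>K\<^esub>}. x = a \<otimes>\<^bsub>K\<^esub> inv\<^bsub>K\<^esub> b)"

text \<open>A valuation is a function on the nonzero elements of \<open>K\<close>. The convention that \<open>0\<close> has
  value infinity is built into the definitions below, and the junk value \<open>\<nu> \<zero>\<close> is never used.
  The value group is the image, which need not be all of \<open>'g\<close>.\<close>

definition valuation :: "'a ring \<Rightarrow> ('a \<Rightarrow> 'g::linordered_ab_group_add) \<Rightarrow> bool" where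
  "valuation K \<nu> \<longleftrightarrow>
     (\<forall>x\<in>carrier K - {\<zero>\<^bsub>K\<^esub>}. \<forall>y\<in>carrier K - {\<zero>\<^bsub>K\<^esub>}.
        \<nu> (x \<otimes>\<^bsub>K\<^esub> y) = \<nu> x + \<nu> y \<and>
        (x \<oplus>\<^bsub>K\<^esub> y \<noteq> \<zero>\<^bsub>K\<^esub> \<longrightarrow> min (\<nu> x) (\<nu> y) \<le> \<nu> (x \<oplus>\<^bsub>K\<^esub> y)))"

definition value_group :: "'a ring \<Rightarrow> ('a \<Rightarrow> 'g::linordered_ab_group_add) \<Rightarrow> 'g set" where
  "value_group K \<nu> = \<nu> ` (carrier K - {\<zero>\<^bsub>K\<^esub>})"

definition valuation_ring :: "'a ring \<Rightarrow> ('a \<Rightarrow> 'g::linordered_ab_group_add) \<Rightarrow> 'a set" where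
  "valuation_ring K \<nu> = {x \<in> carrier K. x = \<zero>\<^bsub>K\<^esub> \<or> 0 \<le> \<nu> x}"

definition valuation_ideal :: "'a ring \<Rightarrow> ('a \<Rightarrow> 'g::linordered_ab_group_add) \<Rightarrow> 'a set" where
  "valuation_ideal K \<nu> = {x \<in> carrier K. x = \<zero>\<^bsub>K\<^esub> \<or> 0 < \<nu> x}"

definition dominates ::
    "'a ring \<Rightarrow> ('a \<Rightarrow> 'g::linordered_ab_group_add) \<Rightarrow> 'a ring \<Rightarrow> 'a set \<Rightarrow> bool" where
  "dominates K \<nu> A m \<longleftrightarrow>
     carrier A \<subseteq> valuation_ring K \<nu> \<and> valuation_ideal K \<nu> \<inter> carrier A = m"

definition value_semigroup ::
    "'a ring \<Rightarrow> ('a \<Rightarrow> 'g::linordered_ab_group_add) \<Rightarrow> 'a set \<Rightarrow> 'g set" where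
  "value_semigroup K \<nu> m = \<nu> ` (m - {\<zero>\<^bsub>K\<^esub>})"

text \<open>An identification of an ordered abelian group \<open>\<Gamma>\<close> with an ordered subgroup of the rationals.\<close>

definition ordered_embedding_into_rat ::
    "'g::linordered_ab_group_add set \<Rightarrow> ('g \<Rightarrow> rat) \<Rightarrow> bool" where
  "ordered_embedding_into_rat \<Gamma> \<phi> \<longleftrightarrow>
     (\<forall>x\<in>\<Gamma>. \<forall>y\<in>\<Gamma>. \<phi> (x + y) = \<phi> x + \<phi> y \<and> (x < y \<longrightarrow> \<phi> x < \<phi> y))"

text \<open>HOL cannot quantify over types inside a formula, so a bare \<open>\<exists>U\<close> in front of rings with
  elements in \<open>'a\<close> and values in \<open>'g\<close> would only give a \<open>U\<close> depending on these two types.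
  Equating \<open>U\<close> with the following constant, in which no type variable occurs, makes a single \<open>U\<close>
  serve all rings and all value groups. It has \<open>2 ^ n\<close> elements in each interval \<open>[n, n + 1)\<close>
  with \<open>n \<ge> 1\<close>.\<close>

definition dyadic_semigroup :: "rat set" where
  "dyadic_semigroup = {x. 1 \<le> x \<and> x * 2 ^ nat \<lfloor>x\<rfloor> \<in> \<int>}"

end

theory Submission
  imports Defs
begin

text \<open>A value semigroup can only grow polynomially, while the dyadic semigroup has \<open>2 ^ n\<close> elements in
  \<open>[n, n + 1)\<close>.

  Let \<open>A\<close> be a noetherian local domain with a dominating valuation \<open>v\<close> whose smallest value on \<open>m\<close> is
  at least \<open>1\<close>, and let \<open>m\<close> be generated by \<open>d\<close> elements. The values of \<open>v\<close> below \<open>n\<close> give a strictly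
  descending chain of ideals \<open>{x. v x \<ge> c}\<close>, all containing \<open>m ^ n\<close>, so their number is at most the
  length of \<open>A / m ^ n\<close>. This length is at most the number of monomials of degree less than \<open>n\<close> in the
  generators, hence at most \<open>n ^ (d + 1)\<close>.

  The proof avoids lengths of modules. Starting from \<open>m ^ n\<close>, whose values are all at least \<open>n\<close>
  (\<open>values_ge_generator_powers\<close>), it adjoins the monomials one at a time in order of decreasing
  degree until the ideal is \<open>A\<close>. If \<open>p\<close> is adjoined to an ideal that already contains \<open>m p\<close>, at most
  one new value appears (\<open>vals_insert_generator\<close>), so that \<open>card_values_less\<close> follows by counting
  monomials (\<open>card_monomials_le\<close>). The powers of \<open>m\<close> are represented by the ideals that the monomials
  of degree \<open>n\<close> in a fixed finite generating set generate.

  The order type of the dyadic semigroup is \<open>\<omega>\<close> because it is infinite and has finitely many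
  elements below each bound (\<open>ordIso_natLeq_finite_below\<close>).\<close>

section \<open>Subsets of order type omega\<close>

lemma well_order_on_finite_below:
  fixes U :: "'b::linorder set"
  assumes fin: "\<And>y. y \<in> U \<Longrightarrow> finite {x \<in> U. x < y}"
  shows "well_order_on U (relation_of (\<le>) U)"
proof -
  let ?r = "relation_of (\<le>) U"
  let ?rank = "\<lambda>y. card {x \<in> U. x < y}"
  have "?rank x < ?rank y" if "x \<in> U" "y \<in> U" "x < y" for x y
    by (rule psubset_card_mono[OF fin]) (use that in auto)
  \<comment> \<open>The number of smaller elements is a strictly increasing rank.\<close>
  then have "?r - Id \<subseteq> measure ?rank"
    by (auto simp: relation_of_def order_le_less)
  then have "wf (?r - Id)"
    by (rule wf_subset[OF wf_measure])
  moreover have "linear_order_on U ?r"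
    unfolding linear_order_on_def partial_order_on_def preorder_on_def
    by (auto simp: relation_of_def refl_on_def total_on_def intro!: transI antisymI)
  ultimately show ?thesis
    by (simp add: well_order_on_def)
qed

text \<open>Well-orders are comparable, and a strict comparison in either direction would make an infinite
  order isomorphic to a proper initial segment of the other, which is finite on both sides.\<close>

lemma ordIso_natLeq_finite_below:
  fixes U :: "'b::linorder set"
  assumes inf: "infinite U" and fin: "\<And>y. y \<in> U \<Longrightarrow> finite {x \<in> U. x < y}"
  shows "(relation_of (\<le>) U, natLeq) \<in> ordIso"
proof -
  let ?r = "relation_of (\<le>) U"
  have field: "Field ?r = U"
    by (auto simp: relation_of_def Field_def)
  have wo: "Well_order ?r"
    unfolding field by (rule well_order_on_finite_below[OF fin])
  have "\<not> natLeq <o ?r"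
  proof
    assume "natLeq <o ?r"
    then obtain a f where "a \<in> U" and f: "bij_betw f (Field natLeq) (Field (Restr ?r (underS ?r a)))"
      unfolding ordLess_iff_ordIso_Restr[OF wo natLeq_Well_order] field
        ordIso_def BNF_Wellorder_Embedding.iso_defs by blast
    have "Field (Restr ?r (underS ?r a)) \<subseteq> {x \<in> U. x < a}"
      by (auto simp: Field_def underS_def relation_of_def)
    then have "finite (Field (Restr ?r (underS ?r a)))"
      using fin[OF \<open>a \<in> U\<close>] finite_subset by blast
    then show False
      using bij_betw_finite[OF f] infinite_UNIV_nat unfolding Field_natLeq by blast
  qed
  moreover have "\<not> ?r <o natLeq"
  proof
    assume "?r <o natLeq"
    then obtain a f where f: "bij_betw f (Field ?r) (Field (Restr natLeq (underS natLeq a)))"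
      unfolding ordLess_iff_ordIso_Restr[OF natLeq_Well_order wo]
        ordIso_def BNF_Wellorder_Embedding.iso_defs by blast
    have "Field (Restr natLeq (underS natLeq a)) \<subseteq> {..a}"
      by (auto simp: Field_def underS_def natLeq_def)
    then have "finite (Field (Restr natLeq (underS natLeq a)))"
      using finite_subset by blast
    then show False
      using bij_betw_finite[OF f] inf unfolding field by blast
  qed
  ultimately show ?thesis
    by (simp add: ordIso_iff_ordLeq not_ordLess_iff_ordLeq[OF wo natLeq_Well_order]
      not_ordLess_iff_ordLeq[OF natLeq_Well_order wo])
qed

section \<open>The dyadic semigroup\<close>

lemma dyadic_mult_power_Ints:
  assumes "x \<in> dyadic_semigroup" and "nat \<lfloor>x\<rfloor> \<le> N"
  shows "x * 2 ^ N \<in> \<int>"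
proof -
  have "x * 2 ^ N = (x * 2 ^ nat \<lfloor>x\<rfloor>) * 2 ^ (N - nat \<lfloor>x\<rfloor>)"
    using assms(2) by (simp add: mult.assoc flip: power_add)
  also have "\<dots> \<in> \<int>"
    using assms(1) Ints_mult[of _ "2 ^ (N - nat \<lfloor>x\<rfloor>)"] by (auto simp: dyadic_semigroup_def)
  finally show ?thesis .
qed

lemma additive_subsemigroup_dyadic: "additive_subsemigroup dyadic_semigroup"
  unfolding additive_subsemigroup_def
proof (intro ballI)
  fix x y assume xy: "x \<in> dyadic_semigroup" "y \<in> dyadic_semigroup"
  then have ge: "1 \<le> x" "1 \<le> y"
    by (auto simp: dyadic_semigroup_def)
  have "nat \<lfloor>x\<rfloor> \<le> nat \<lfloor>x + y\<rfloor>" "nat \<lfloor>y\<rfloor> \<le> nat \<lfloor>x + y\<rfloor>"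
    using ge by (auto intro!: nat_mono floor_mono)
  then have "(x + y) * 2 ^ nat \<lfloor>x + y\<rfloor> \<in> \<int>"
    unfolding distrib_right using xy by (intro Ints_add dyadic_mult_power_Ints)
  then show "x + y \<in> dyadic_semigroup"
    using ge by (simp add: dyadic_semigroup_def)
qed

lemma finite_dyadic_below: "finite {x \<in> dyadic_semigroup. x < y}"
proof -
  define N where "N = nat \<lfloor>y\<rfloor>"
  have "{x \<in> dyadic_semigroup. x < y} \<subseteq> (\<lambda>k. of_int k / 2 ^ N) ` {0..\<lfloor>y * 2 ^ N\<rfloor>}"
  proof
    fix x assume "x \<in> {x \<in> dyadic_semigroup. x < y}"
    then have x: "x \<in> dyadic_semigroup" "x < y" "1 \<le> x"
      by (auto simp: dyadic_semigroup_def)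
    have "x * 2 ^ N \<in> \<int>"
      using x unfolding N_def by (intro dyadic_mult_power_Ints nat_mono floor_mono) auto
    then obtain k where k: "x * 2 ^ N = of_int k"
      by (auto elim: Ints_cases)
    have "0 \<le> x * 2 ^ N" "x * 2 ^ N \<le> y * 2 ^ N"
      using x by auto
    then have "k \<in> {0..\<lfloor>y * 2 ^ N\<rfloor>}"
      unfolding k by (auto simp: le_floor_iff)
    moreover have "x = of_int k / 2 ^ N"
      using k by (simp add: field_simps)
    ultimately show "x \<in> (\<lambda>k. of_int k / 2 ^ N) ` {0..\<lfloor>y * 2 ^ N\<rfloor>}"
      by blast
  qed
  then show ?thesis
    by (rule finite_subset) simp
qed

lemma infinite_dyadic: "infinite dyadic_semigroup"
proof -
  have "inj (\<lambda>n. rat_of_nat (Suc n))"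
    by (auto simp: inj_on_def)
  then have "infinite (range (\<lambda>n. rat_of_nat (Suc n)))"
    using finite_imageD infinite_UNIV_nat by blast
  moreover have "range (\<lambda>n. rat_of_nat (Suc n)) \<subseteq> dyadic_semigroup"
    by (auto simp: dyadic_semigroup_def intro!: Ints_mult Ints_add)
  ultimately show ?thesis
    using finite_subset by blast
qed

lemma card_dyadic_below:
  assumes "0 < n"
  shows "2 ^ n \<le> card {x \<in> dyadic_semigroup. x < of_nat (Suc n)}"
proof -
  \<comment> \<open>The \<open>2 ^ n\<close> elements of \<open>[n, n + 1)\<close> already suffice.\<close>
  define f :: "nat \<Rightarrow> rat" where "f k = of_nat n + of_nat k / 2 ^ n" for k
  have "f k \<in> {x \<in> dyadic_semigroup. x < of_nat (Suc n)}" if "k < 2 ^ n" for k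
  proof -
    have "rat_of_nat k < 2 ^ n"
      using that by (metis of_nat_less_iff of_nat_numeral of_nat_power)
    then have b: "of_nat n \<le> f k" "f k < of_nat (Suc n)"
      by (auto simp: f_def field_simps)
    then have "\<lfloor>f k\<rfloor> = int n"
      by (intro floor_unique) auto
    moreover have "f k * 2 ^ n = of_nat (n * 2 ^ n + k)"
      by (simp add: f_def field_simps)
    ultimately have "f k * 2 ^ nat \<lfloor>f k\<rfloor> \<in> \<int>"
      by (metis Ints_of_nat nat_int)
    moreover have "1 \<le> f k"
      using b(1) assms of_nat_mono[of 1 n, where 'a = rat] by simp
    ultimately show ?thesis
      using b(2) by (simp add: dyadic_semigroup_def)
  qed
  then have "f ` {..<2 ^ n} \<subseteq> {x \<in> dyadic_semigroup. x < of_nat (Suc n)}"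
    by auto
  then have "card (f ` {..<2 ^ n}) \<le> card {x \<in> dyadic_semigroup. x < of_nat (Suc n)}"
    by (rule card_mono[OF finite_dyadic_below])
  moreover have "inj_on f {..<2 ^ n}"
    by (auto simp: f_def inj_on_def)
  ultimately show ?thesis
    by (simp add: card_image)
qed

section \<open>Monomials in the generators of an ideal\<close>

primrec (in monoid) monomials :: "'a set \<Rightarrow> nat \<Rightarrow> 'a set" where
  "monomials gs 0 = {\<one>}"
| "monomials gs (Suc n) = {x \<otimes> p |x p. x \<in> gs \<and> p \<in> monomials gs n}"

lemma (in monoid) monomials_closed:
  "gs \<subseteq> carrier G \<Longrightarrow> monomials gs n \<subseteq> carrier G"
  by (induction n) auto

text \<open>By commutativity a monomial is determined by its exponents, which number \<open>card gs\<close> and are at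
  most its degree. That is why the count is polynomial in \<open>n\<close>, although there are \<open>card gs ^ n\<close>
  words of length \<open>n\<close>.\<close>

lemma (in comm_monoid) card_monomials_le:
  assumes gs: "finite gs" "gs \<subseteq> carrier G"
  shows "finite (monomials gs n)" and "card (monomials gs n) \<le> Suc n ^ card gs"
proof -
  let ?M = "\<lambda>e. \<Otimes>x\<in>gs. x [^] (e x :: nat)"
  have "monomials gs n \<subseteq> ?M ` (gs \<rightarrow>\<^sub>E {..n})"
  proof (induction n)
    case 0
    have "?M (\<lambda>x\<in>gs. 0) = \<one>"
      by (rule finprod_one_eqI) auto
    then show ?case
      by (auto intro!: image_eqI[of _ _ "\<lambda>x\<in>gs. 0"])
  next
    case (Suc n)
    show ?case
    proof
      fix q assume "q \<in> monomials gs (Suc n)"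
      then obtain x e where q: "q = x \<otimes> ?M e" and x: "x \<in> gs" and e: "e \<in> gs \<rightarrow>\<^sub>E {..n}"
        using Suc by auto
      let ?e = "e(x := Suc (e x))"
      have xc: "x \<in> carrier G" "(\<lambda>y. y) \<in> gs \<rightarrow> carrier G"
        using x gs by auto
      have "(\<Otimes>y\<in>gs. if x = y then y else \<one>) = x"
        by (rule finprod_singleton) (use x gs in auto)
      then have "q = (\<Otimes>y\<in>gs. if x = y then y else \<one>) \<otimes> ?M e"
        using q by simp
      also have "\<dots> = (\<Otimes>y\<in>gs. (if x = y then y else \<one>) \<otimes> y [^] e y)"
        by (rule finprod_multf[symmetric]) (use gs in auto)
      also have "\<dots> = ?M ?e"
        by (rule finprod_cong') (use gs in \<open>auto simp: m_comm\<close>)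
      finally have "q = ?M ?e" .
      moreover have "?e \<in> gs \<rightarrow>\<^sub>E {..Suc n}"
        using e x by (auto simp: PiE_iff extensional_def intro: le_SucI)
      ultimately show "q \<in> ?M ` (gs \<rightarrow>\<^sub>E {..Suc n})"
        by blast
    qed
  qed
  moreover have fin: "finite (gs \<rightarrow>\<^sub>E {..n})"
    using gs by (intro finite_PiE) auto
  ultimately show "finite (monomials gs n)"
    using finite_subset by blast
  have "card (monomials gs n) \<le> card (?M ` (gs \<rightarrow>\<^sub>E {..n}))"
    using \<open>monomials gs n \<subseteq> _\<close> fin by (intro card_mono) auto
  also have "\<dots> \<le> card (gs \<rightarrow>\<^sub>E {..n})"
    using fin by (rule card_image_le)
  also have "\<dots> = Suc n ^ card gs"
    using gs by (simp add: card_PiE)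
  finally show "card (monomials gs n) \<le> Suc n ^ card gs" .
qed

lemma (in cring) genideal_insert_elim:
  assumes T: "T \<subseteq> carrier R" and p: "p \<in> carrier R" and f: "f \<in> Idl (insert p T)"
  obtains a j where "a \<in> carrier R" "j \<in> Idl T" "f = a \<otimes> p \<oplus> j"
proof -
  interpret T: ideal "Idl T" R
    by (rule genideal_ideal[OF T])
  have "ideal (PIdl p <+> Idl T) R"
    by (intro add_ideals cgenideal_ideal p T.is_ideal)
  moreover have "insert p T \<subseteq> PIdl p <+> Idl T"
  proof -
    have "p \<oplus> \<zero> \<in> PIdl p <+> Idl T"
      unfolding set_add_def' using cgenideal_self[OF p] T.zero_closed by blast
    moreover have "\<zero> \<oplus> t \<in> PIdl p <+> Idl T" if "t \<in> T" for t
      unfolding set_add_def' using genideal_self[OF T] that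
        additive_subgroup.zero_closed[OF ideal.axioms(1)[OF cgenideal_ideal[OF p]]] by blast
    ultimately show ?thesis
      using p T by (auto simp: subset_iff)
  qed
  ultimately have "f \<in> PIdl p <+> Idl T"
    using genideal_minimal f by blast
  then show thesis
    using that by (auto simp: set_add_def' cgenideal_def)
qed

text \<open>This is \<open>I I ^ n \<subseteq> I ^ (n + 1)\<close>. The multipliers that carry \<open>p\<close> into the ideal on the right
  form an ideal, so it suffices to multiply by the generators of \<open>I\<close>.\<close>

lemma (in cring) genideal_mult_monomials:
  assumes gs: "gs \<subseteq> carrier R" and a: "a \<in> Idl gs" and p: "p \<in> monomials gs n"
  shows "a \<otimes> p \<in> Idl (monomials gs (Suc n))"
proof -
  have pc: "p \<in> carrier R"
    using p monomials_closed[OF gs] by blast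
  have M: "monomials gs (Suc n) \<subseteq> carrier R"
    by (rule monomials_closed[OF gs])
  let ?J = "{x \<in> carrier R. p \<otimes> x \<in> Idl (monomials gs (Suc n))}"
  have "ideal ?J R"
    by (rule ideal.helper_max_prime[OF genideal_ideal[OF M] is_cring pc])
  moreover have "gs \<subseteq> ?J"
  proof
    fix x assume x: "x \<in> gs"
    then have "x \<otimes> p \<in> Idl (monomials gs (Suc n))"
      using p genideal_self[OF M] by auto
    then show "x \<in> ?J"
      using x gs pc by (auto simp: m_comm)
  qed
  ultimately have "a \<in> ?J"
    using a genideal_minimal by blast
  then show ?thesis
    using pc by (auto simp: m_comm)
qed

section \<open>Counting the values of a valuation\<close>

text \<open>The values lie in an ordered ring because they are compared with natural numbers.\<close>

locale valued_domain = domain R for R (structure) +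
  fixes v :: "'a \<Rightarrow> 'v::linordered_idom"
  assumes v_mult: "\<lbrakk>x \<in> carrier R - {\<zero>}; y \<in> carrier R - {\<zero>}\<rbrakk> \<Longrightarrow> v (x \<otimes> y) = v x + v y"
    and v_add: "\<lbrakk>x \<in> carrier R - {\<zero>}; y \<in> carrier R - {\<zero>}; x \<oplus> y \<noteq> \<zero>\<rbrakk>
      \<Longrightarrow> min (v x) (v y) \<le> v (x \<oplus> y)"
    and v_nonneg: "x \<in> carrier R - {\<zero>} \<Longrightarrow> 0 \<le> v x"
begin

definition center :: "'a set" where
  "center = {x \<in> carrier R. x = \<zero> \<or> 0 < v x}"

definition vals :: "'a set \<Rightarrow> 'v set" where
  "vals J = v ` (J - {\<zero>})"

lemma v_one: "v \<one> = 0"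
  using v_mult[of \<one> \<one>] by simp

lemma v_minus:
  assumes "x \<in> carrier R - {\<zero>}"
  shows "v (\<ominus> x) = v x"
proof -
  have one: "\<ominus> \<one> \<in> carrier R - {\<zero>}"
    using add.inv_eq_1_iff by auto
  have "(\<ominus> \<one>) \<otimes> (\<ominus> \<one>) = \<one>"
    by (simp add: l_minus)
  then have "v (\<ominus> \<one>) + v (\<ominus> \<one>) = 0"
    using v_mult[OF one one] v_one by simp
  then have "v (\<ominus> \<one>) = 0"
    by simp
  moreover have "\<ominus> x = (\<ominus> \<one>) \<otimes> x"
    using assms by (simp add: l_minus)
  ultimately show ?thesis
    using v_mult[OF one assms] by simp
qed

text \<open>The ultrametric inequality is an equality when the two values differ.\<close>

lemma v_diff_less:
  assumes x: "x \<in> carrier R - {\<zero>}" and y: "y \<in> carrier R - {\<zero>}" and less: "v x < v y"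
  shows "x \<ominus> y \<in> carrier R - {\<zero>}" and "v (x \<ominus> y) = v x"
proof -
  have x_eq: "(x \<ominus> y) \<oplus> y = x"
    using x y by (simp add: minus_eq a_assoc l_neg)
  have "x \<ominus> y \<noteq> \<zero>"
    using x_eq y less by auto
  then show d: "x \<ominus> y \<in> carrier R - {\<zero>}"
    using x y by auto
  have "\<ominus> y \<in> carrier R - {\<zero>}"
    using y add.inv_eq_1_iff by auto
  then have "v x \<le> v (x \<ominus> y)"
    using v_add[of x "\<ominus> y"] x y d less v_minus[OF y] by (simp add: minus_eq)
  moreover have "min (v (x \<ominus> y)) (v y) \<le> v x"
    using v_add[OF d y] x x_eq by simp
  ultimately show "v (x \<ominus> y) = v x"
    using less by linarith
qed

lemma ideal_values_ge: "ideal {x \<in> carrier R. x = \<zero> \<or> c \<le> v x} R" (is "ideal ?I R")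
proof (rule idealI[OF ring_axioms])
  have mult: "x \<otimes> a \<in> ?I" if "a \<in> ?I" "x \<in> carrier R" for a x
  proof (cases "a = \<zero> \<or> x = \<zero>")
    case False
    then show ?thesis
      using that v_mult[of x a] v_nonneg[of x] by auto
  qed (use that in auto)
  then show "x \<otimes> a \<in> ?I" "a \<otimes> x \<in> ?I" if "a \<in> ?I" "x \<in> carrier R" for a x
    using that by (auto simp: m_comm)
  show "subgroup ?I (add_monoid R)"
  proof (rule add.subgroupI)
    show "\<ominus> a \<in> ?I" if "a \<in> ?I" for a
      using that v_minus[of a] by (cases "a = \<zero>") auto
    show "a \<oplus> b \<in> ?I" if "a \<in> ?I" "b \<in> ?I" for a b
      using that v_add[of a b] by (cases "a = \<zero> \<or> b = \<zero> \<or> a \<oplus> b = \<zero>") auto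
  qed auto
qed

text \<open>If \<open>f = a p + j\<close> and \<open>g = b p + j'\<close> both had values outside those of \<open>Idl T\<close>, then \<open>a\<close> and \<open>b\<close>
  would lie outside the center, so have value \<open>0\<close>. The combination \<open>b f - a g\<close> cancels \<open>p\<close> and lies
  in \<open>Idl T\<close>, but if \<open>v f < v g\<close> it has the value of \<open>f\<close>.\<close>

lemma vals_insert_generator:
  assumes T: "T \<subseteq> carrier R" and p: "p \<in> carrier R"
    and center_p: "\<And>a. a \<in> center \<Longrightarrow> a \<otimes> p \<in> Idl T"
  shows "\<exists>c. vals (Idl (insert p T)) - vals (Idl T) \<subseteq> {c}"
proof -
  interpret T: ideal "Idl T" R
    by (rule genideal_ideal[OF T])
  interpret J: ideal "Idl (insert p T)" R
    by (rule genideal_ideal) (use T p in auto)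
  have unit: "\<exists>a j. a \<in> carrier R - {\<zero>} \<and> v a = 0 \<and> j \<in> Idl T \<and> f = a \<otimes> p \<oplus> j"
    if f: "f \<in> Idl (insert p T) - {\<zero>}" "v f \<notin> vals (Idl T)" for f
  proof -
    obtain a j where aj: "a \<in> carrier R" "j \<in> Idl T" "f = a \<otimes> p \<oplus> j"
      using genideal_insert_elim[OF T p] f(1) by blast
    have "f \<notin> Idl T"
      using f by (auto simp: vals_def)
    then have "a \<otimes> p \<notin> Idl T"
      using aj by (auto intro: T.a_closed)
    then have "a \<notin> center"
      using center_p by blast
    then have "a \<noteq> \<zero>" "v a = 0"
      using aj(1) v_nonneg[of a] by (auto simp: center_def)
    then show ?thesis
      using aj by blast
  qed
  have "\<not> v f < v g"
    if f: "f \<in> Idl (insert p T) - {\<zero>}" "v f \<notin> vals (Idl T)"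
      and g: "g \<in> Idl (insert p T) - {\<zero>}" "v g \<notin> vals (Idl T)" for f g
  proof
    assume less: "v f < v g"
    obtain a j where a: "a \<in> carrier R - {\<zero>}" "v a = 0" "j \<in> Idl T" "f = a \<otimes> p \<oplus> j"
      using unit[OF f] by blast
    obtain b k where b: "b \<in> carrier R - {\<zero>}" "v b = 0" "k \<in> Idl T" "g = b \<otimes> p \<oplus> k"
      using unit[OF g] by blast
    have jk: "j \<in> carrier R" "k \<in> carrier R"
      using a b T.Icarr by auto
    have fg: "f \<in> carrier R - {\<zero>}" "g \<in> carrier R - {\<zero>}"
      using f g J.Icarr by auto
    have bf: "b \<otimes> f \<in> carrier R - {\<zero>}" "v (b \<otimes> f) = v f"
      using fg b v_mult[of b f] integral by auto
    have ag: "a \<otimes> g \<in> carrier R - {\<zero>}" "v (a \<otimes> g) = v g"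
      using fg a v_mult[of a g] integral by auto
    have "b \<otimes> f \<ominus> a \<otimes> g = b \<otimes> j \<ominus> a \<otimes> k"
    proof -
      have "a \<in> carrier R" "b \<in> carrier R"
        using a b by auto
      then show ?thesis
        unfolding a(4) b(4) using jk p by algebra
    qed
    also have "\<dots> \<in> Idl T"
      unfolding minus_eq using a b by (intro T.a_closed T.a_inv_closed T.I_l_closed) auto
    finally have "b \<otimes> f \<ominus> a \<otimes> g \<in> Idl T - {\<zero>}"
      using v_diff_less(1)[OF bf(1) ag(1)] less bf ag by auto
    then have "v (b \<otimes> f \<ominus> a \<otimes> g) \<in> vals (Idl T)"
      unfolding vals_def by (rule imageI)
    then show False
      using v_diff_less(2)[OF bf(1) ag(1)] less bf ag f by simp
  qed
  then have "\<not> c < d"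
    if "c \<in> vals (Idl (insert p T)) - vals (Idl T)"
      "d \<in> vals (Idl (insert p T)) - vals (Idl T)"
    for c d
    using that unfolding vals_def by blast
  then have "c = d"
    if "c \<in> vals (Idl (insert p T)) - vals (Idl T)"
      "d \<in> vals (Idl (insert p T)) - vals (Idl T)"
    for c d
    using that linorder_neqE by metis
  then show ?thesis
    by blast
qed

text \<open>The hypothesis on products with the center persists when \<open>T\<close> grows, so the generators can be
  adjoined in any order.\<close>

lemma vals_union_generators:
  assumes T: "T \<subseteq> carrier R" and S: "finite S" "S \<subseteq> carrier R"
    and center_S: "\<And>a p. \<lbrakk>a \<in> center; p \<in> S\<rbrakk> \<Longrightarrow> a \<otimes> p \<in> Idl T"
  shows "finite (vals (Idl (S \<union> T)) - vals (Idl T)) \<and>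
    card (vals (Idl (S \<union> T)) - vals (Idl T)) \<le> card S"
  using S center_S
proof (induction S rule: finite_induct)
  case (insert p S)
  let ?V = "vals (Idl (S \<union> T)) - vals (Idl T)"
  have IH: "finite ?V" "card ?V \<le> card S"
    using insert by auto
  have "Idl T \<subseteq> Idl (S \<union> T)"
    using insert.prems T by (intro subset_Idl_subset) auto
  then have "\<exists>c. vals (Idl (insert p (S \<union> T))) - vals (Idl (S \<union> T)) \<subseteq> {c}"
    using insert.prems T by (intro vals_insert_generator) auto
  then obtain c where "vals (Idl (insert p S \<union> T)) - vals (Idl T) \<subseteq> insert c ?V"
    by auto
  moreover have "finite (insert c ?V)" "card (insert c ?V) \<le> card (insert p S)"
    using IH insert.hyps card_insert_le_m1[of "card (insert p S)" ?V c] by auto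
  ultimately show ?case
    by (meson card_mono finite_subset order_trans)
qed simp

text \<open>Passing from degree \<open>n + 1\<close> to degree \<open>n\<close> adjoins at most \<open>(n + 1) ^ card gs\<close> monomials, which the
  center multiplies into degree \<open>n + 1\<close>. The bound is the crude estimate of the sum of these numbers
  by \<open>n\<close> times its largest term.\<close>

lemma vals_generator_powers:
  assumes gs: "finite gs" "gs \<subseteq> carrier R" "Idl gs = center"
  shows "finite (vals (carrier R) - vals (Idl (monomials gs n))) \<and>
    card (vals (carrier R) - vals (Idl (monomials gs n))) \<le> n * n ^ card gs"
proof (induction n)
  case 0
  show ?case
    by (simp add: genideal_one)
next
  case (Suc n)
  let ?M = "monomials gs n" and ?M' = "monomials gs (Suc n)"
  let ?A = "vals (carrier R) - vals (Idl ?M)" and ?B = "vals (Idl (?M \<union> ?M')) - vals (Idl ?M')"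
  have M: "?M \<subseteq> carrier R" "?M' \<subseteq> carrier R"
    using monomials_closed[OF gs(2)] by blast+
  have B: "finite ?B \<and> card ?B \<le> card ?M"
    by (rule vals_union_generators[OF M(2) card_monomials_le(1)[OF gs(1,2)] M(1)])
      (use genideal_mult_monomials[OF gs(2)] gs(3) in auto)
  have "Idl ?M \<subseteq> Idl (?M \<union> ?M')"
    using M by (intro subset_Idl_subset) auto
  then have sub: "vals (carrier R) - vals (Idl ?M') \<subseteq> ?A \<union> ?B"
    by (auto simp: vals_def)
  have "card (?A \<union> ?B) \<le> n * n ^ card gs + Suc n ^ card gs"
    using card_Un_le[of ?A ?B] Suc.IH B card_monomials_le(2)[OF gs(1,2), of n] by linarith
  also have "\<dots> \<le> Suc n * Suc n ^ card gs"
    using mult_le_mono2[OF power_mono[of n "Suc n" "card gs"], of n] by simp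
  finally show ?case
    using card_mono[OF _ sub] finite_subset[OF sub] Suc.IH B by (meson finite_UnI order_trans)
qed

lemma values_ge_generator_powers:
  assumes gs: "gs \<subseteq> center" and ge: "\<And>x. x \<in> center - {\<zero>} \<Longrightarrow> 1 \<le> v x"
    and c: "c \<in> vals (Idl (monomials gs n))"
  shows "of_nat n \<le> c"
proof -
  have XR: "gs \<subseteq> carrier R"
    using gs by (auto simp: center_def)
  have "monomials gs n \<subseteq> {x \<in> carrier R. x = \<zero> \<or> of_nat n \<le> v x}"
  proof (induction n)
    case 0
    show ?case
      by (simp add: v_one)
  next
    case (Suc n)
    show ?case
    proof
      fix q assume "q \<in> monomials gs (Suc n)"
      then obtain x p where q: "q = x \<otimes> p" "x \<in> gs" "p \<in> carrier R" "p = \<zero> \<or> of_nat n \<le> v p"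
        using Suc by auto
      have x: "x \<in> carrier R" "x = \<zero> \<or> 1 \<le> v x"
        using q(2) gs XR ge by auto
      show "q \<in> {x \<in> carrier R. x = \<zero> \<or> of_nat (Suc n) \<le> v x}"
      proof (cases "x = \<zero> \<or> p = \<zero>")
        case False
        then have "v q = v x + v p"
          using q x v_mult by auto
        then show ?thesis
          using False q x by (auto intro: add_mono)
      qed (use q x in auto)
    qed
  qed
  then have "Idl (monomials gs n) \<subseteq> {x \<in> carrier R. x = \<zero> \<or> of_nat n \<le> v x}"
    by (rule genideal_minimal[OF ideal_values_ge])
  then show ?thesis
    using c by (auto simp: vals_def)
qed

theorem card_values_less:
  assumes gs: "finite gs" "gs \<subseteq> carrier R" "Idl gs = center"
    and ge: "\<And>x. x \<in> center - {\<zero>} \<Longrightarrow> 1 \<le> v x"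
  shows "finite {c \<in> vals (carrier R). c < of_nat n}"
    and "card {c \<in> vals (carrier R). c < of_nat n} \<le> n ^ Suc (card gs)"
proof -
  let ?V = "vals (carrier R) - vals (Idl (monomials gs n))"
  have "gs \<subseteq> center"
    using genideal_self[OF gs(2)] gs(3) by simp
  then have sub: "{c \<in> vals (carrier R). c < of_nat n} \<subseteq> ?V"
  proof (intro subsetI DiffI)
    fix c assume c: "c \<in> {c \<in> vals (carrier R). c < of_nat n}"
    then show "c \<in> vals (carrier R)"
      by simp
    show "c \<notin> vals (Idl (monomials gs n))"
      using values_ge_generator_powers[OF \<open>gs \<subseteq> center\<close> ge, of c n] c by auto
  qed
  have V: "finite ?V" "card ?V \<le> n ^ Suc (card gs)"
    using vals_generator_powers[OF gs, of n] by auto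
  show "finite {c \<in> vals (carrier R). c < of_nat n}"
    using sub V(1) finite_subset by blast
  show "card {c \<in> vals (carrier R). c < of_nat n} \<le> n ^ Suc (card gs)"
    using card_mono[OF V(1) sub] V(2) by linarith
qed

end

section \<open>Exponential against polynomial growth\<close>

lemma ex_power_less_two_power: "\<exists>n>0. Suc n ^ k < (2::nat) ^ n"
proof -
  \<comment> \<open>For \<open>n = 2 ^ j - 1\<close> the claim becomes \<open>j k < 2 ^ j - 1\<close>, and \<open>j \<ge> 5\<close> gives \<open>j ^ 2 < 2 ^ j\<close>.\<close>
  define j where "j = k + 5"
  have sq: "j ^ 2 < 2 ^ j"
  proof -
    have "5 \<le> j"
      by (simp add: j_def)
    then show ?thesis
    proof (induction j rule: dec_induct)
      case (step i)
      have "2 * i + 1 \<le> i * i"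
        using mult_le_mono1[OF step(1), of i] step(1) by linarith
      then show ?case
        using step.IH by (simp add: power2_eq_square)
    qed simp
  qed
  have "j * k < 2 ^ j - 1"
    using sq by (simp add: j_def power2_eq_square algebra_simps)
  moreover have "(2::nat) ^ j > 1"
    by (rule one_less_power) (auto simp: j_def)
  ultimately have "Suc (2 ^ j - 1) ^ k < (2::nat) ^ (2 ^ j - 1)" "0 < (2::nat) ^ j - 1"
    by (auto simp flip: power_mult)
  then show ?thesis
    by blast
qed

section \<open>The dyadic semigroup is not a value semigroup\<close>

text \<open>After composition with the embedding, values can be compared with the natural numbers.\<close>

lemma valued_domain_of_dominating_valuation:
  fixes A :: "'a ring" and \<nu> :: "'a \<Rightarrow> 'g::linordered_ab_group_add"
  assumes dom: "domain A" and quot: "quotient_field_of K A" and val: "valuation K \<nu>"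
    and domin: "dominates K \<nu> A m"
    and emb: "ordered_embedding_into_rat (value_group K \<nu>) \<phi>"
  shows "valued_domain A (\<lambda>x. \<phi> (\<nu> x))" and "valued_domain.center A (\<lambda>x. \<phi> (\<nu> x)) = m"
proof -
  interpret domain A by (rule dom)
  interpret K: field K
    using quot by (simp add: quotient_field_of_def)
  have sub: "carrier A \<subseteq> carrier K"
    using quot by (auto simp: quotient_field_of_def dest: subringE(1))
  have A: "A = K\<lparr>carrier := carrier A\<rparr>"
    using quot by (simp add: quotient_field_of_def)
  have ops: "\<zero>\<^bsub>A\<^esub> = \<zero>\<^bsub>K\<^esub>" "x \<otimes>\<^bsub>A\<^esub> y = x \<otimes>\<^bsub>K\<^esub> y" "x \<oplus>\<^bsub>A\<^esub> y = x \<oplus>\<^bsub>K\<^esub> y" for x y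
    by (subst A, simp)+
  have group: "\<nu> x \<in> value_group K \<nu>" if "x \<in> carrier K - {\<zero>\<^bsub>K\<^esub>}" for x
    using that by (auto simp: value_group_def)
  have "\<nu> \<one>\<^bsub>K\<^esub> = \<nu> \<one>\<^bsub>K\<^esub> + \<nu> \<one>\<^bsub>K\<^esub>"
    using val by (auto simp: valuation_def dest!: bspec[of _ _ "\<one>\<^bsub>K\<^esub>"])
  then have zero: "0 \<in> value_group K \<nu>"
    using group[of "\<one>\<^bsub>K\<^esub>"] by simp
  have "\<phi> (0 + 0) = \<phi> 0 + \<phi> 0"
    using emb zero unfolding ordered_embedding_into_rat_def by blast
  then have phi0: "\<phi> 0 = 0"
    by simp
  have less_iff: "\<phi> x < \<phi> y \<longleftrightarrow> x < y" if "x \<in> value_group K \<nu>" "y \<in> value_group K \<nu>" for x y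
    using emb that unfolding ordered_embedding_into_rat_def by (metis less_asym linorder_neqE order.irrefl)
  have le_iff: "\<phi> x \<le> \<phi> y \<longleftrightarrow> x \<le> y" if "x \<in> value_group K \<nu>" "y \<in> value_group K \<nu>" for x y
    using less_iff[OF that(2,1)] by (simp add: linorder_not_less[symmetric])
  show vd: "valued_domain A (\<lambda>x. \<phi> (\<nu> x))"
  proof (unfold_locales)
    fix x assume x: "x \<in> carrier A - {\<zero>\<^bsub>A\<^esub>}"
    then have "0 \<le> \<nu> x"
      using domin by (auto simp: dominates_def valuation_ring_def ops)
    then show "0 \<le> \<phi> (\<nu> x)"
      using le_iff[OF zero group[of x]] x sub phi0 by (auto simp: ops)
    fix y assume y: "y \<in> carrier A - {\<zero>\<^bsub>A\<^esub>}"
    have xy: "x \<in> carrier K - {\<zero>\<^bsub>K\<^esub>}" "y \<in> carrier K - {\<zero>\<^bsub>K\<^esub>}"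
      using x y sub by (auto simp: ops)
    have "\<nu> (x \<otimes>\<^bsub>K\<^esub> y) = \<nu> x + \<nu> y"
      using val xy unfolding valuation_def by blast
    then show "\<phi> (\<nu> (x \<otimes>\<^bsub>A\<^esub> y)) = \<phi> (\<nu> x) + \<phi> (\<nu> y)"
      using emb xy group unfolding ordered_embedding_into_rat_def by (auto simp: ops)
    assume nz: "x \<oplus>\<^bsub>A\<^esub> y \<noteq> \<zero>\<^bsub>A\<^esub>"
    then have "min (\<nu> x) (\<nu> y) \<le> \<nu> (x \<oplus>\<^bsub>K\<^esub> y)"
      using val xy unfolding valuation_def by (metis ops(1,3))
    moreover have "x \<oplus>\<^bsub>K\<^esub> y \<in> carrier K - {\<zero>\<^bsub>K\<^esub>}"
      using nz xy by (auto simp: ops)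
    ultimately show "min (\<phi> (\<nu> x)) (\<phi> (\<nu> y)) \<le> \<phi> (\<nu> (x \<oplus>\<^bsub>A\<^esub> y))"
      using xy group by (simp add: ops min_le_iff_disj le_iff)
  qed
  have "m = {x \<in> carrier A. x = \<zero>\<^bsub>A\<^esub> \<or> 0 < \<nu> x}"
    using domin sub by (auto simp: dominates_def valuation_ideal_def ops)
  also have "\<dots> = {x \<in> carrier A. x = \<zero>\<^bsub>A\<^esub> \<or> 0 < \<phi> (\<nu> x)}"
    using less_iff[OF zero group] sub phi0 by (auto simp: ops)
  finally show "valued_domain.center A (\<lambda>x. \<phi> (\<nu> x)) = m"
    by (simp add: valued_domain.center_def[OF vd])
qed

theorem dyadic_not_value_semigroup:
  fixes A :: "'a ring" and \<nu> :: "'a \<Rightarrow> 'g::linordered_ab_group_add"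
  assumes noeth: "noetherian_domain A" and m: "ideal m A"
    and quot: "quotient_field_of K A" and val: "valuation K \<nu>" and domin: "dominates K \<nu> A m"
    and emb: "ordered_embedding_into_rat (value_group K \<nu>) \<phi>"
  shows "dyadic_semigroup \<noteq> \<phi> ` value_semigroup K \<nu> m"
proof
  assume eq: "dyadic_semigroup = \<phi> ` value_semigroup K \<nu> m"
  interpret noetherian_domain A by (rule noeth)
  interpret valued_domain A "\<lambda>x. \<phi> (\<nu> x)"
    by (rule valued_domain_of_dominating_valuation[OF domain_axioms quot val domin emb])
  have center: "center = m"
    by (rule valued_domain_of_dominating_valuation[OF domain_axioms quot val domin emb])
  have "A = K\<lparr>carrier := carrier A\<rparr>"
    using quot by (simp add: quotient_field_of_def)
  then have "\<zero>\<^bsub>A\<^esub> = \<zero>\<^bsub>K\<^esub>"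
    by (rule ssubst) simp
  then have eq': "dyadic_semigroup = (\<lambda>x. \<phi> (\<nu> x)) ` (m - {\<zero>\<^bsub>A\<^esub>})"
    using eq by (simp add: value_semigroup_def image_image)
  obtain gs where gs: "finite gs" "gs \<subseteq> carrier A" "Idl\<^bsub>A\<^esub> gs = center"
    using finetely_gen[OF m] center by metis
  have "1 \<le> \<phi> (\<nu> x)" if "x \<in> center - {\<zero>\<^bsub>A\<^esub>}" for x
  proof -
    have "\<phi> (\<nu> x) \<in> dyadic_semigroup"
      using that center eq' by blast
    then show ?thesis
      by (simp add: dyadic_semigroup_def)
  qed
  note bound = card_values_less[OF gs this]
  obtain n where n: "0 < n" "Suc n ^ Suc (card gs) < 2 ^ n"
    using ex_power_less_two_power by blast
  have "dyadic_semigroup \<subseteq> vals (carrier A)"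
    using eq' ideal.Icarr[OF m] by (auto simp: vals_def)
  then have "card {x \<in> dyadic_semigroup. x < of_nat (Suc n)}
      \<le> card {c \<in> vals (carrier A). c < of_nat (Suc n)}"
    by (intro card_mono bound(1)) auto
  then show False
    using card_dyadic_below[OF n(1)] bound(2)[of "Suc n"] n(2) by linarith
qed

theorem mainTheorem3:
  shows "\<exists>U::rat set. U = dyadic_semigroup \<and>
    U \<subseteq> {0<..} \<and> additive_subsemigroup U \<and> well_ordered_set U \<and> has_ordinal_type_omega U \<and>
    (\<forall>(A::'a ring) m K (\<nu>::'a \<Rightarrow> 'g::linordered_ab_group_add) \<phi>.
       equicharacteristic_noetherian_local_domain A m \<and> quotient_field_of K A \<and>
       valuation K \<nu> \<and> dominates K \<nu> A m \<and>
       ordered_embedding_into_rat (value_group K \<nu>) \<phi>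
       \<longrightarrow> U \<noteq> \<phi> ` value_semigroup K \<nu> m)"
proof (intro exI[of _ dyadic_semigroup] conjI allI impI)
  show "dyadic_semigroup \<subseteq> {0<..}"
    by (auto simp: dyadic_semigroup_def)
  show "additive_subsemigroup dyadic_semigroup"
    by (rule additive_subsemigroup_dyadic)
  show "well_ordered_set dyadic_semigroup"
    unfolding well_ordered_set_def by (rule well_order_on_finite_below[OF finite_dyadic_below])
  show "has_ordinal_type_omega dyadic_semigroup"
    unfolding has_ordinal_type_omega_def
    by (rule ordIso_natLeq_finite_below[OF infinite_dyadic finite_dyadic_below])
  fix A :: "'a ring" and m K and \<nu> :: "'a \<Rightarrow> 'g" and \<phi>
  assume *: "equicharacteristic_noetherian_local_domain A m \<and> quotient_field_of K A \<and>
       valuation K \<nu> \<and> dominates K \<nu> A m \<and>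
       ordered_embedding_into_rat (value_group K \<nu>) \<phi>"
  then have "noetherian_domain A" "ideal m A"
    by (simp_all add: equicharacteristic_noetherian_local_domain_def local_ring_def
        maximalideal.axioms(1))
  with * show "dyadic_semigroup \<noteq> \<phi> ` value_semigroup K \<nu> m"
    using dyadic_not_value_semigroup by blast
qed simp

end
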